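(* Let $x$ and $k$ be indeterminates, let $K=\mathbb{Q}(x,k)$, and let $A_n^{(k)}(x)$, $n\ge 0$, be the $1/k$-Eulerian polynomials. Let $M$ be the exponential Riordan array $$M=\left[\frac{1}{(1+kxz)(1+kz)^{1/k}},\ \frac{1}{k(1-x)}\ln\left(\frac{1+kz}{1+kxz}\right)\right]$$ over $K$. Then $M$ is the coefficient array of a family of orthogonal polynomials over $K$ whose moments are the once-shifted $1/k$-Eulerian polynomials $(A_{n+1}^{(k)}(x))_{n\ge 0}$. Moreover, the inverse matrix of $M$ is the exponential Riordan array $$M^{-1}=\left[e^{kz(x-1)}\left(\frac{1-x}{e^{kz(x-1)}-x}\right)^{1/k+1},\ \frac{e^{kz}-e^{kxz}}{k(e^{kxz}-xe^{kz})}\right],$$ and the once-shifted $1/k$-Eulerian polynomials form its initial column, i.e. $(M^{-1})_{n,0}=A_{n+1}^{(k)}(x)$ for all $n\ge 0$.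
   Context: The Savage-Viswanathan polynomials $F_n(x,y)$ are defined by the exponential generating function $\sum_{n\ge 0}F_n(x,y)\frac{z^n}{n!}=\left(\frac{1-x}{e^{z(x-1)}-x}\right)^y$ (a formal power series in $z$; the base has constant term $1$). They are polynomials in $x,y$. The $1/k$-Eulerian polynomials are $A_n^{(k)}(x)=k^nF_n(x,1/k)$. All series are formal power series in $z$; for a series $u$ with constant term $1$, $u^{c}=\exp(c\ln u)$. For formal power series $g(z)$ with $g(0)\ne 0$ and $f(z)=f_1z+f_2z^2+\cdots$ with $f_1\neq 0$, the exponential Riordan array $[g,f]$ is the infinite lower-triangular matrix $(a_{n,j})_{n,j\ge 0}$ whose $j$-th column has exponential generating function $g(z)f(z)^j/j!$, i.e. $a_{n,j}=n!\,[z^n]\,g(z)f(z)^j/j!$. A lower-triangular matrix $(a_{n,j})$ is the coefficient array of the polynomials $p_n(z)=\sum_{j=0}^n a_{n,j}z^j$. A sequence of monic polynomials $(p_n)_{n\ge0}$ over a field $K$ with $\deg p_n=n$ is (formally) orthogonal with moments $(\mu_n)_{n\ge 0}$ if the $K$-linear functional $\mathcal{L}$ on $K[z]$ with $\mathcal{L}(z^n)=\mu_n$ satisfies $\mathcal{L}(p_mp_n)=0$ for $m\neq n$ and $\mathcal{L}(p_n^2)\ne 0$ for all $n$. *)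

theory Defs
  imports "HOL-Computational_Algebra.Computational_Algebra"
begin

text \<open>The field \<open>K = \<rat>(x,k)\<close> as the fraction field of \<open>\<rat>[k][x]\<close>: the outer polynomial
  variable is \<open>x\<close>, the inner one is \<open>k\<close>.\<close>

type_synonym ratfun = "rat poly poly fract"

definition indet_x :: ratfun where
  "indet_x = to_fract [:0, 1:]"

definition indet_k :: ratfun where
  "indet_k = to_fract [:[:0, 1:]:]"


text \<open>Logarithms and powers of a series \<open>u\<close>; meaningful only if \<open>u\<close> has constant term \<open>1\<close>.
  Note that \<open>fps_ln 1\<close> is the series of \<open>ln (1 + z)\<close>.\<close>

definition fps_log1 :: "'a::field_char_0 fps \<Rightarrow> 'a fps" where
  "fps_log1 u = fps_compose (fps_ln 1) (u - 1)"

definition fps_pow1 :: "'a::field_char_0 fps \<Rightarrow> 'a \<Rightarrow> 'a fps" where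
  "fps_pow1 u c = fps_compose (fps_exp 1) (fps_const c * fps_log1 u)"


text \<open>The values \<open>F\<^sub>n(x,y)\<close> at elements \<open>x \<noteq> 1\<close> and \<open>y\<close> of a field of characteristic \<open>0\<close>. For
  \<open>x = 1\<close> the quotient below is not a series with constant term \<open>1\<close>, and the definition is
  meaningless.\<close>

definition savage_viswanathan :: "nat \<Rightarrow> 'a::field_char_0 \<Rightarrow> 'a \<Rightarrow> 'a" where
  "savage_viswanathan n x y =
     fact n * fps_nth (fps_pow1 (fps_const (1 - x) / (fps_exp (x - 1) - fps_const x)) y) n"

definition k_eulerian :: "'a::field_char_0 \<Rightarrow> nat \<Rightarrow> 'a \<Rightarrow> 'a" where
  "k_eulerian k n x = k ^ n * savage_viswanathan n x (1 / k)"


definition lower_triangular :: "(nat \<Rightarrow> nat \<Rightarrow> 'a::zero) \<Rightarrow> bool" where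
  "lower_triangular A \<longleftrightarrow> (\<forall>n j. n < j \<longrightarrow> A n j = 0)"

text \<open>For lower triangular \<open>A\<close> all further terms of the row-by-column sum vanish.\<close>

definition lt_mult :: "(nat \<Rightarrow> nat \<Rightarrow> 'a::semiring_1) \<Rightarrow> (nat \<Rightarrow> nat \<Rightarrow> 'a) \<Rightarrow> nat \<Rightarrow> nat \<Rightarrow> 'a" where
  "lt_mult A B n j = (\<Sum>i\<le>n. A n i * B i j)"

definition lt_one :: "nat \<Rightarrow> nat \<Rightarrow> 'a::semiring_1" where
  "lt_one n j = (if n = j then 1 else 0)"

definition lt_inverse :: "(nat \<Rightarrow> nat \<Rightarrow> 'a::semiring_1) \<Rightarrow> (nat \<Rightarrow> nat \<Rightarrow> 'a) \<Rightarrow> bool" where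
  "lt_inverse A B \<longleftrightarrow> lower_triangular A \<and> lower_triangular B \<and>
     lt_mult A B = lt_one \<and> lt_mult B A = lt_one"


definition exp_riordan_admissible :: "'a::field_char_0 fps \<Rightarrow> 'a fps \<Rightarrow> bool" where
  "exp_riordan_admissible g f \<longleftrightarrow> fps_nth g 0 \<noteq> 0 \<and> fps_nth f 0 = 0 \<and> fps_nth f 1 \<noteq> 0"

definition exp_riordan :: "'a::field_char_0 fps \<Rightarrow> 'a fps \<Rightarrow> nat \<Rightarrow> nat \<Rightarrow> 'a" where
  "exp_riordan g f n j = fact n * fps_nth (g * f ^ j) n / fact j"


definition coefficient_array :: "(nat \<Rightarrow> nat \<Rightarrow> 'a::comm_monoid_add) \<Rightarrow> (nat \<Rightarrow> 'a poly) \<Rightarrow> bool" where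
  "coefficient_array A p \<longleftrightarrow>
     lower_triangular A \<and> (\<forall>n. p n = (\<Sum>j\<le>n. monom (A n j) j))"

text \<open>The unique linear functional sending the \<open>n\<close>-th power of the variable to \<open>\<mu> n\<close>; see the
  three lemmas after the definition.\<close>

definition moment_functional :: "(nat \<Rightarrow> 'a::field) \<Rightarrow> 'a poly \<Rightarrow> 'a" where
  "moment_functional \<mu> p = (\<Sum>i\<le>degree p. coeff p i * \<mu> i)"

lemma moment_functional_altdef:
  assumes "degree p \<le> n"
  shows "moment_functional \<mu> p = (\<Sum>i\<le>n. coeff p i * \<mu> i)"
  unfolding moment_functional_def
  by (rule sum.mono_neutral_left) (use assms in \<open>auto simp: coeff_eq_0\<close>)

lemma moment_functional_add:
  "moment_functional \<mu> (p + q) = moment_functional \<mu> p + moment_functional \<mu> q"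
proof -
  define n where "n = max (degree p) (degree q)"
  have "degree p \<le> n" "degree q \<le> n" "degree (p + q) \<le> n"
    by (auto simp: n_def degree_add_le_max)
  then show ?thesis
    by (simp add: moment_functional_altdef sum.distrib algebra_simps)
qed

lemma moment_functional_smult:
  "moment_functional \<mu> (smult c p) = c * moment_functional \<mu> p"
  by (simp add: moment_functional_altdef[OF degree_smult_le] moment_functional_def
      sum_distrib_left mult.assoc)

lemma moment_functional_monom: "moment_functional \<mu> (monom 1 n) = \<mu> n"
  by (simp add: moment_functional_def degree_monom_eq if_distrib[of "\<lambda>c. c * _"]
      cong: if_cong)

definition orthogonal_with_moments :: "(nat \<Rightarrow> 'a::field poly) \<Rightarrow> (nat \<Rightarrow> 'a) \<Rightarrow> bool" where
  "orthogonal_with_moments p \<mu> \<longleftrightarrow>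
     (\<forall>n. degree (p n) = n \<and> lead_coeff (p n) = 1) \<and>
     (\<forall>m n. m \<noteq> n \<longrightarrow> moment_functional \<mu> (p m * p n) = 0) \<and>
     (\<forall>n. moment_functional \<mu> (p n * p n) \<noteq> 0)"

end

theory Submission
  imports Defs
begin

text \<open>Put \<open>E = e\<^bsup>k(x-1)z\<^esup>\<close> and \<open>B = (1 - x) / (E - x)\<close>. Then \<open>1 + k f' = B\<close> and \<open>1 + k x f' = E B\<close>,
  so \<open>f \<circ> f' = z\<close> and \<open>g' (g \<circ> f') = 1\<close>, which makes the two Riordan arrays inverse to each other;
  moreover \<open>g'\<close> is the derivative of \<open>B\<^bsup>1/k\<^esup>\<close>, the exponential generating function of the
  \<open>1/k\<close>-Eulerian polynomials. Differentiating the columns \<open>g f\<^bsup>j\<^esup>\<close> gives the recurrence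
  \<open>p\<^bsub>n+1\<^esub> = (t - (kx + 1) - k(1 + x)n) p\<^bsub>n\<^esub> - kxn(kn + 1) p\<^bsub>n-1\<^esub>\<close> for the row polynomials in \<open>t\<close>.
  Since row \<open>n\<close> of \<open>M\<close> times the initial column of \<open>M\<^bsup>-1\<^esup>\<close> is \<open>0\<close> for \<open>n > 0\<close>, the functional with
  these moments kills \<open>p\<^bsub>n\<^esub>\<close> for \<open>n > 0\<close>, and the recurrence yields orthogonality.\<close>

section \<open>Logarithms and powers of formal power series\<close>

lemma fps_log1_nth_0 [simp]: "fps_nth (fps_log1 u) 0 = 0"
  by (simp add: fps_log1_def)

lemma fps_pow1_nth_0 [simp]: "fps_nth (fps_pow1 u c) 0 = 1"
  by (simp add: fps_pow1_def)

lemma fps_log1_deriv: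
  fixes u :: "'a::field_char_0 fps"
  assumes "fps_nth u 0 = 1"
  shows "fps_deriv (fps_log1 u) = fps_deriv u * inverse u"
proof -
  have "fps_deriv (fps_log1 u) = (inverse (1 + fps_X) oo (u - 1)) * fps_deriv u"
    using assms by (simp add: fps_log1_def fps_compose_deriv fps_ln_deriv)
  also have "inverse (1 + fps_X) oo (u - 1) = inverse u"
    using assms by (subst fps_inverse_compose) (simp_all add: fps_compose_add_distrib)
  finally show ?thesis by (simp add: mult.commute)
qed

lemma fps_pow1_deriv:
  fixes u :: "'a::field_char_0 fps"
  assumes "fps_nth u 0 = 1"
  shows "fps_deriv (fps_pow1 u c) = fps_const c * fps_deriv u * inverse u * fps_pow1 u c"
  using assms by (simp add: fps_pow1_def fps_compose_deriv fps_log1_deriv algebra_simps)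

lemma fps_log1_compose:
  fixes u :: "'a::field_char_0 fps"
  assumes "fps_nth u 0 = 1" "fps_nth v 0 = 0"
  shows "fps_log1 u oo v = fps_log1 (u oo v)"
  using assms by (simp add: fps_log1_def fps_compose_assoc[symmetric] fps_compose_sub_distrib)

lemma fps_pow1_compose:
  fixes u :: "'a::field_char_0 fps"
  assumes "fps_nth u 0 = 1" "fps_nth v 0 = 0"
  shows "fps_pow1 u c oo v = fps_pow1 (u oo v) c"
  using assms
  by (simp add: fps_pow1_def fps_compose_assoc[symmetric] fps_compose_mult_distrib fps_log1_compose)

text \<open>The quotient \<open>a * inverse b\<close> has derivative 0, so it is constant, and the
  constant terms make it 1. This uniqueness for y' = w y yields the power laws below.\<close>

lemma fps_eq_of_same_log_deriv:
  fixes a b :: "'a::field_char_0 fps"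
  assumes "fps_deriv a = w * a" "fps_deriv b = w * b"
    and "fps_nth a 0 = fps_nth b 0" "fps_nth b 0 \<noteq> 0"
  shows "a = b"
proof -
  have b: "inverse b * b = 1" using assms(4) by (simp add: inverse_mult_eq_1)
  have "fps_deriv (a * inverse b) = w * a * inverse b - w * a * inverse b * (inverse b * b)"
    using assms by (simp add: fps_inverse_deriv power2_eq_square algebra_simps)
  then have "fps_deriv (a * inverse b) = 0" by (simp add: b)
  then have "a * inverse b = fps_const (fps_nth (a * inverse b) 0)"
    by (rule fps_deriv_eq_0_iff[THEN iffD1])
  then have "a * inverse b = 1" using assms(3,4) by simp
  then have "a * (inverse b * b) = b" by (simp add: mult.assoc[symmetric])
  then show ?thesis by (simp add: b)
qed

lemma fps_pow1_add:
  fixes u :: "'a::field_char_0 fps"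
  assumes "fps_nth u 0 = 1"
  shows "fps_pow1 u (c + d) = fps_pow1 u c * fps_pow1 u d"
  by (rule fps_eq_of_same_log_deriv[where w = "fps_const (c + d) * fps_deriv u * inverse u"])
    (simp_all add: fps_pow1_deriv[OF assms] fps_const_add[symmetric] algebra_simps
      del: fps_const_add)

lemma fps_pow1_one:
  fixes u :: "'a::field_char_0 fps"
  assumes "fps_nth u 0 = 1"
  shows "fps_pow1 u 1 = u"
proof (rule fps_eq_of_same_log_deriv[where w = "fps_deriv u * inverse u"])
  have "inverse u * u = 1" using assms by (simp add: inverse_mult_eq_1)
  then show "fps_deriv u = fps_deriv u * inverse u * u" by (simp add: mult.assoc)
qed (use assms in \<open>simp_all add: fps_pow1_deriv\<close>)

lemma fps_log1_exp:
  fixes a :: "'a::field_char_0"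
  shows "fps_log1 (fps_exp a) = fps_const a * fps_X"
proof -
  have "fps_deriv (fps_log1 (fps_exp a)) = fps_const a * (inverse (fps_exp a) * fps_exp a)"
    by (simp add: fps_log1_deriv algebra_simps)
  then have "fps_deriv (fps_log1 (fps_exp a)) = fps_deriv (fps_const a * fps_X)"
    by (simp add: inverse_mult_eq_1)
  then show ?thesis unfolding fps_deriv_eq_iff by simp
qed


section \<open>Exponential Riordan arrays\<close>

lemma lower_triangular_exp_riordan:
  assumes "fps_nth f 0 = 0"
  shows "lower_triangular (exp_riordan g f)"
proof -
  have "fps_nth (g * f ^ j) n = 0" if "n < j" for n j
    using assms that by (auto simp: fps_mult_nth startsby_zero_power_prefix intro!: sum.neutral)
  then show ?thesis by (simp add: lower_triangular_def exp_riordan_def)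
qed

text \<open>The fundamental theorem of Riordan arrays: \<open>[g, f]\<close> sends a column with
  exponential generating function \<open>w\<close> to one with \<open>g * (w oo f)\<close>. It is
  applied to each column \<open>u * v ^ j\<close>, where the factorials cancel.\<close>

lemma lt_mult_exp_riordan:
  fixes g f u v :: "'a::field_char_0 fps"
  assumes "fps_nth f 0 = 0"
  shows "lt_mult (exp_riordan g f) (exp_riordan u v) = exp_riordan (g * (u oo f)) (v oo f)"
proof (intro ext)
  fix n j
  have "fps_nth (g * (w oo f)) n = (\<Sum>i\<le>n. fps_nth w i * fps_nth (g * f ^ i) n)" for w :: "'a fps"
  proof -
    have "fps_nth (g * (w oo f)) n
        = (\<Sum>m\<le>n. fps_nth g m * (\<Sum>i\<le>n - m. fps_nth w i * fps_nth (f ^ i) (n - m)))"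
      by (simp add: fps_mult_nth fps_compose_nth atLeast0AtMost)
    \<comment> \<open>\<open>f ^ i\<close> has no terms below degree \<open>i\<close>, so the longer
      range adds only zeros and lets the two sums be interchanged.\<close>
    also have "\<dots> = (\<Sum>m\<le>n. fps_nth g m * (\<Sum>i\<le>n. fps_nth w i * fps_nth (f ^ i) (n - m)))"
      using assms startsby_zero_power_prefix[of f]
      by (intro sum.cong refl arg_cong2[where f = "(*)"] sum.mono_neutral_left) auto
    also have "\<dots> = (\<Sum>i\<le>n. fps_nth w i * (\<Sum>m\<le>n. fps_nth g m * fps_nth (f ^ i) (n - m)))"
      unfolding sum_distrib_left by (subst sum.swap) (simp add: algebra_simps)
    finally show ?thesis by (simp add: fps_mult_nth atLeast0AtMost)
  qed
  from this[of "u * v ^ j"]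
  show "lt_mult (exp_riordan g f) (exp_riordan u v) n j = exp_riordan (g * (u oo f)) (v oo f) n j"
    by (simp add: lt_mult_def exp_riordan_def fps_compose_mult_distrib[OF assms]
        fps_compose_power[OF assms] mult.assoc[symmetric] sum_distrib_left sum_divide_distrib)
      (simp add: mult_ac)
qed

lemma exp_riordan_1_X: "exp_riordan 1 fps_X = lt_one"
  by (auto simp: exp_riordan_def lt_one_def fun_eq_iff fps_X_power_nth)

text \<open>One-sided identities suffice: \<open>fv\<close> forces \<open>v\<close> to be the
  compositional inverse of \<open>f\<close>, and composing \<open>gu\<close> with \<open>f\<close>
  then gives the identity for the other product.\<close>

lemma lt_inverse_exp_riordan:
  fixes g f u v :: "'a::field_char_0 fps"
  assumes f: "fps_nth f 0 = 0" "fps_nth f 1 \<noteq> 0" and v: "fps_nth v 0 = 0"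
    and fv: "f oo v = fps_X" and gu: "u * (g oo v) = 1"
  shows "lt_inverse (exp_riordan g f) (exp_riordan u v)"
proof -
  have "v = (fps_inv f oo f) oo v" using f v by (simp add: fps_inv)
  also have "\<dots> = fps_inv f"
    using f v fv by (simp add: fps_compose_assoc[symmetric])
  finally have vf: "v oo f = fps_X" using f by (simp add: fps_inv)
  have "(u * (g oo v)) oo f = (u oo f) * g"
    using f v by (simp add: fps_compose_mult_distrib fps_compose_assoc[symmetric] vf)
  then have "g * (u oo f) = 1" using gu by (simp add: mult.commute)
  with f v fv vf gu show ?thesis
    by (simp add: lt_inverse_def lower_triangular_exp_riordan lt_mult_exp_riordan exp_riordan_1_X)
qed


section \<open>Orthogonality from a three-term recurrence\<close>

text \<open>Moves a factor t from the left polynomial to \<open>p\<close>, where a three-term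
  recurrence can absorb it.\<close>

lemma moment_functional_pCons_mult:
  "moment_functional \<mu> (pCons c q * p)
     = c * moment_functional \<mu> p + moment_functional \<mu> (q * pCons 0 p)"
  by (simp add: moment_functional_add moment_functional_smult)

text \<open>The easy direction of Favard's theorem. For \<open>n = 0\<close> the truncated index
  \<open>n - 1\<close> is again 0, and \<open>b 0 = 0\<close> removes that term.\<close>

lemma orthogonal_of_three_term_recurrence:
  fixes p :: "nat \<Rightarrow> 'a::field poly"
  assumes p0: "p 0 = 1"
    and rec: "\<And>n. p (Suc n) = pCons 0 (p n) - smult (a n) (p n) - smult (b n) (p (n - 1))"
    and b: "b 0 = 0" "\<And>n. n > 0 \<Longrightarrow> b n \<noteq> 0"
    and L: "\<And>n. moment_functional \<mu> (p n) = (if n = 0 then 1 else 0)"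
  shows "orthogonal_with_moments p \<mu>"
proof -
  have monic: "degree (p n) = n \<and> lead_coeff (p n) = 1" for n
  proof (induction n rule: less_induct)
    case (less n)
    show ?case
    proof (cases n)
      case 0
      then show ?thesis by (simp add: p0)
    next
      case (Suc m)
      have m: "degree (p m) = m" "coeff (p m) m = 1" "degree (p (m - 1)) \<le> m"
        using less[of m] less[of "m - 1"] Suc by auto
      have c: "coeff (p n) n = 1"
        using m by (simp add: Suc rec coeff_eq_0)
      have "degree (p n) \<le> n"
        unfolding Suc rec using m
        by (intro degree_diff_le) (auto intro: order.trans[OF degree_pCons_le]
            order.trans[OF degree_smult_le])
      with c show ?thesis using le_degree[of "p n" n] by auto
    qed
  qed
  \<comment> \<open>\<open>h n\<close> will be the squared norm of \<open>p n\<close>, the value of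
    the functional at \<open>p n * p n\<close>.\<close>
  define h where "h n = (\<Prod>i=1..n. b i)" for n
  have h_nonzero: "h n \<noteq> 0" for n using b(2) by (simp add: h_def)
  have h_rec: "b n * h (n - 1) = h n" if "n > 0" for n
    using that by (cases n) (simp_all add: h_def)
  \<comment> \<open>Against \<open>p n\<close>, a polynomial of degree at most n is seen only
    through its coefficient at t^n. Both orthogonality and the norms follow.\<close>
  have key: "moment_functional \<mu> (q * p n) = coeff q n * h n" if "degree q \<le> n" for q n
    using that
  proof (induction q arbitrary: n)
    case 0
    then show ?case by (simp add: moment_functional_def)
  next
    case (pCons c q)
    show ?case
    proof (cases "q = 0")
      case True
      then show ?thesis
        by (cases n) (simp_all add: moment_functional_smult L h_def coeff_pCons)
    next
      case False
      with pCons.prems have n: "n > 0" "degree q \<le> n - 1" by auto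
      \<comment> \<open>The recurrence solved for t \<open>p n\<close>. As \<open>q\<close> has
        degree at most \<open>n - 1\<close>, the induction hypothesis leaves only the term with
        \<open>p (n - 1)\<close>.\<close>
      have "q * pCons 0 (p n) = q * p (Suc n) + smult (a n) (q * p n) + smult (b n) (q * p (n - 1))"
        by (simp add: rec algebra_simps)
      then have "moment_functional \<mu> (pCons c q * p n) = b n * (coeff q (n - 1) * h (n - 1))"
        unfolding moment_functional_pCons_mult using n
        by (simp add: moment_functional_add moment_functional_smult L pCons.IH coeff_eq_0)
      then show ?thesis
        using n h_rec[OF n(1)] by (cases n) (simp_all add: mult.left_commute)
    qed
  qed
  have zero: "moment_functional \<mu> (p m * p n) = 0" if "m < n" for m n
    using that monic[of m] by (simp add: key coeff_eq_0)
  have "moment_functional \<mu> (p m * p n) = 0" if "m \<noteq> n" for m n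
    using that zero[of m n] zero[of n m] by (cases "m < n") (auto simp: mult.commute)
  moreover have "moment_functional \<mu> (p n * p n) \<noteq> 0" for n
    using monic[of n] key[of "p n" n] h_nonzero[of n] by (metis mult_1 order_refl)
  ultimately show ?thesis
    unfolding orthogonal_with_moments_def using monic by blast
qed


section \<open>The Riordan arrays of the shifted \<open>1/k\<close>-Eulerian polynomials\<close>

text \<open>The computation works over any such field; further nonvanishing properties of the
  indeterminates enter only as assumptions of \<open>orthogonal\<close>.\<close>

locale eulerian_riordan =
  fixes k x :: "'a::field_char_0"
  assumes k_nonzero: "k \<noteq> 0" and x_neq_1: "x \<noteq> 1"
begin

definition E :: "'a fps" where
  "E = fps_exp (k * (x - 1))"

definition B :: "'a fps" where
  "B = fps_const (1 - x) / (E - fps_const x)"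

definition g :: "'a fps" where
  "g = 1 / ((1 + fps_const (k * x) * fps_X) * fps_pow1 (1 + fps_const k * fps_X) (1 / k))"

definition f :: "'a fps" where
  "f = fps_const (1 / (k * (1 - x))) *
      fps_log1 ((1 + fps_const k * fps_X) / (1 + fps_const (k * x) * fps_X))"

definition g' :: "'a fps" where
  "g' = E * fps_pow1 B (1 / k + 1)"

definition f' :: "'a fps" where
  "f' = (fps_exp k - fps_exp (k * x)) /
      (fps_const k * (fps_exp (k * x) - fps_const x * fps_exp k))"

section \<open>Closed forms in terms of \<open>E\<close> and \<open>B\<close>\<close>

lemma E_nth_0 [simp]: "fps_nth E 0 = 1"
  by (simp add: E_def)

lemma B_eq: "B = fps_const (1 - x) * inverse (E - fps_const x)"
  using x_neq_1 by (simp add: B_def fps_divide_unit)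

lemma B_nth_0 [simp]: "fps_nth B 0 = 1"
  using x_neq_1 by (simp add: B_eq)

lemma inverse_denominator: "inverse (E - fps_const x) * (E - fps_const x) = 1"
  using x_neq_1 by (simp add: inverse_mult_eq_1)

lemma B_deriv: "fps_deriv B = fps_const k * E * B\<^sup>2"
proof -
  have "fps_deriv B = - (fps_const (1 - x) * fps_deriv E * (inverse (E - fps_const x))\<^sup>2)"
    using x_neq_1 by (simp add: B_eq fps_inverse_deriv)
  \<comment> \<open>Writing k(x-1) as -k(1-x) supplies the second factor 1-x that completes
    \<open>B\<^sup>2\<close>.\<close>
  also have "fps_deriv E = - (fps_const k * fps_const (1 - x) * E)"
  proof -
    have "fps_const (k * (x - 1)) = - (fps_const k * fps_const (1 - x))"
      by (simp add: algebra_simps)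
    then show ?thesis by (simp only: E_def fps_exp_deriv minus_mult_left)
  qed
  finally show ?thesis by (simp add: B_eq power2_eq_square algebra_simps)
qed

lemma g'_eq: "g' = E * B * fps_pow1 B (1 / k)"
  by (simp add: g'_def fps_pow1_add fps_pow1_one algebra_simps)

text \<open>(1/k) B'/B = E B by \<open>B_deriv\<close>. Differentiation shifts an exponential
  generating function by one index, hence the once-shifted moments.\<close>

lemma g'_eq_deriv: "g' = fps_deriv (fps_pow1 B (1 / k))"
proof -
  have "inverse B * B = 1" by (simp add: inverse_mult_eq_1)
  moreover have "fps_const (1 / k) * fps_const k = 1" using k_nonzero by simp
  ultimately show ?thesis
    unfolding g'_eq by (simp only: fps_pow1_deriv[OF B_nth_0] B_deriv) algebra
qed

lemma f'_eq: "f' = fps_const (1 / k) * (1 - E) * inverse (E - fps_const x)"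
proof -
  have exp_kx: "fps_exp (k * x) = fps_exp k * E"
    by (simp add: E_def fps_exp_add_mult[symmetric] algebra_simps)
  \<comment> \<open>The common factor e^(kz) cancels, leaving an expression in \<open>E\<close>
    alone.\<close>
  have "f' = ((1 - E) * fps_exp k) / ((fps_const k * (E - fps_const x)) * fps_exp k)"
    unfolding f'_def exp_kx
    by (intro arg_cong2[where f = "(/)"]; simp only: right_diff_distrib left_diff_distrib mult_1_left mult_1_right mult_ac)
  also have "\<dots> = (1 - E) / (fps_const k * (E - fps_const x))"
    by (rule fps_divide_cancel) simp
  also have "\<dots> = fps_const (1 / k) * (1 - E) * inverse (E - fps_const x)"
    using k_nonzero x_neq_1
    by (subst fps_divide_unit)
      (simp_all only: fps_inverse_mult fps_const_inverse inverse_eq_divide, simp_all add: mult_ac)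
  finally show ?thesis .
qed

section \<open>Substituting \<open>f'\<close> into \<open>f\<close> and \<open>g\<close>\<close>

lemma f'_nth_0 [simp]: "fps_nth f' 0 = 0"
  by (simp add: f'_eq)

lemma f'_nth_1: "fps_nth f' 1 = 1"
  using k_nonzero x_neq_1
  by (simp add: f'_eq fps_mult_nth E_def field_simps)

lemma one_plus_k_f': "1 + fps_const k * f' = B"
proof -
  have "fps_const (1 / k) * fps_const k = 1" using k_nonzero by simp
  moreover have "fps_const (1 - x) = 1 - fps_const x" by (simp add: fps_const_sub[symmetric]
        del: fps_const_sub)
  ultimately show ?thesis
    using inverse_denominator unfolding f'_eq B_eq by algebra
qed

lemma one_plus_kx_f': "1 + fps_const (k * x) * f' = E * B"
proof -
  have "fps_const (1 / k) * fps_const k = 1" using k_nonzero by simp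
  moreover have "fps_const (1 - x) = 1 - fps_const x" by (simp add: fps_const_sub[symmetric]
        del: fps_const_sub)
  moreover have "fps_const (k * x) = fps_const k * fps_const x" by simp
  ultimately show ?thesis
    using inverse_denominator unfolding f'_eq B_eq by algebra
qed

text \<open>Under \<open>f'\<close> the argument of the logarithm becomes B/(EB) = e^(k(1-x)z), and
  the prefactor of \<open>f\<close> cancels k(1-x).\<close>

lemma f_compose_f': "f oo f' = fps_X"
proof -
  have "((1 + fps_const k * fps_X) / (1 + fps_const (k * x) * fps_X)) oo f' = B / (E * B)"
    by (subst fps_divide_compose)
      (simp_all add: fps_compose_add_distrib fps_compose_mult_distrib one_plus_k_f' one_plus_kx_f')
  also have "\<dots> = fps_exp (k * (1 - x)) * (B * inverse B)"
    by (simp add: fps_divide_unit fps_inverse_mult E_def fps_exp_neg[symmetric] algebra_simps)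
  also have "\<dots> = fps_exp (k * (1 - x))" by (simp add: inverse_mult_eq_1')
  finally show ?thesis
    using k_nonzero x_neq_1
    by (simp add: f_def fps_compose_mult_distrib fps_log1_compose fps_log1_exp
        mult.assoc[symmetric] fps_divide_unit)
qed

lemma g'_mult_g_compose_f': "g' * (g oo f') = 1"
proof -
  have "g oo f' = inverse g'"
    by (simp add: g_def fps_divide_unit fps_inverse_compose fps_compose_add_distrib
        fps_compose_mult_distrib fps_pow1_compose one_plus_k_f' one_plus_kx_f' g'_eq)
  then show ?thesis by (simp add: inverse_mult_eq_1' g'_eq)
qed

section \<open>Differential equations and the recurrence\<close>

lemma f_nth_0 [simp]: "fps_nth f 0 = 0"
  by (simp add: f_def)

lemma ode_f: "(1 + fps_const k * fps_X) * (1 + fps_const (k * x) * fps_X) * fps_deriv f = 1"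
proof -
  define U where "U = 1 + fps_const (k * x) * fps_X"
  define V where "V = 1 + fps_const k * fps_X"
  have U0: "fps_nth U 0 = 1" and V0: "fps_nth V 0 = 1" by (simp_all add: U_def V_def)
  have U: "inverse U * U = 1" and V: "inverse V * V = 1"
    by (simp_all add: inverse_mult_eq_1 U0 V0)
  have dU: "fps_deriv U = fps_const k * fps_const x" and dV: "fps_deriv V = fps_const k"
    by (simp_all add: U_def V_def)
  have "fps_deriv f = fps_const (1 / (k * (1 - x))) * (fps_deriv (V * inverse U) * inverse (V * inverse U))"
    by (simp add: f_def fps_log1_deriv fps_divide_unit U_def[symmetric] V_def[symmetric] U0 V0)
  also have "inverse (V * inverse U) = inverse V * U"
    by (simp add: fps_inverse_mult U0)
  also have "fps_deriv (V * inverse U)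
      = fps_const k * inverse U - V * (fps_const k * fps_const x) * (inverse U)\<^sup>2"
    by (simp only: fps_deriv_mult fps_inverse_deriv U0 dU dV one_neq_zero not_False_eq_True)
      algebra
  finally have df: "fps_deriv f = fps_const (1 / (k * (1 - x))) *
      ((fps_const k * inverse U - V * (fps_const k * fps_const x) * (inverse U)\<^sup>2) * (inverse V * U))" .
  \<comment> \<open>The numerator of the logarithmic derivative of \<open>V\<close> /
    \<open>U\<close>: its linear terms cancel, and the prefactor of \<open>f\<close> normalizes the
    remaining constant.\<close>
  have UV: "fps_const k * U - fps_const k * fps_const x * V = fps_const (k * (1 - x))"
    by (simp add: U_def V_def fps_eq_iff algebra_simps)
  have "fps_const (1 / (k * (1 - x))) * fps_const (k * (1 - x)) = 1"
    using k_nonzero x_neq_1 by simp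
  then have "V * U * fps_deriv f = 1"
    using U V UV unfolding df by algebra
  then show ?thesis by (simp only: U_def V_def)
qed

lemma f_nth_1: "fps_nth f 1 = 1"
  using arg_cong[OF ode_f, of "\<lambda>h. fps_nth h 0"] by simp

lemma g_nth_0 [simp]: "fps_nth g 0 = 1"
  by (simp add: g_def)

text \<open>The logarithmic derivative of \<open>g\<close> is -kx/(1+kxz) - 1/(1+kz), since the
  exponent 1/k cancels the derivative k of 1+kz. Clearing denominators gives a linear
  polynomial.\<close>

lemma ode_g:
  "(1 + fps_const k * fps_X) * (1 + fps_const (k * x) * fps_X) * fps_deriv g
     = - (fps_const (k * x + 1) + fps_const (k * x * (k + 1)) * fps_X) * g"
proof -
  define U where "U = 1 + fps_const (k * x) * fps_X"
  define V where "V = 1 + fps_const k * fps_X"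
  define P where "P = fps_pow1 V (1 / k)"
  have U0: "fps_nth U 0 = 1" and V0: "fps_nth V 0 = 1" and P0: "fps_nth P 0 = 1"
    by (simp_all add: U_def V_def P_def)
  have V: "inverse V * V = 1" by (simp add: inverse_mult_eq_1 V0)
  have g: "g = inverse (U * P)"
    by (simp add: g_def fps_divide_unit U_def V_def P_def)
  have gUP: "g * (U * P) = 1" unfolding g by (simp add: inverse_mult_eq_1 U0 P0)
  have dU: "fps_deriv U = fps_const (k * x)" by (simp add: U_def)
  have dP: "fps_deriv P = inverse V * P"
    using k_nonzero V0 by (simp add: P_def fps_pow1_deriv) (simp add: V_def mult.assoc[symmetric])
  have dg: "fps_deriv g = - (fps_const (k * x) * P + U * (inverse V * P)) * g\<^sup>2"
    by (simp add: g fps_inverse_deriv U0 P0 dU dP algebra_simps)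
  have "V * U * fps_deriv g = - (fps_const (k * x) * V + U) * g"
    using V gUP unfolding dg by algebra
  also have "fps_const (k * x) * V + U
      = fps_const (k * x + 1) + fps_const (k * x * (k + 1)) * fps_X"
    by (simp add: U_def V_def fps_eq_iff algebra_simps)
  finally show ?thesis by (simp only: U_def V_def)
qed

text \<open>Multiplied by the quadratic (1+kz)(1+kxz), the derivative of a column satisfies an
  equation with polynomial coefficients; the coefficients at z^n are compared. For
  \<open>j = 0\<close> the factor \<open>of_nat j\<close> hides the truncated exponent.\<close>

lemma column_recurrence:
  fixes n j :: nat
  defines "c \<equiv> g * f ^ j"
  shows "of_nat (Suc n) * fps_nth c (Suc n)
    = of_nat j * fps_nth (g * f ^ (j - 1)) n - (k * x + 1 + k * (1 + x) * of_nat n) * fps_nth c n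
      - (if n = 0 then 0 else k * x * (k * of_nat n + 1) * fps_nth c (n - 1))"
proof -
  define Q where "Q = (1 + fps_const k * fps_X) * (1 + fps_const (k * x) * fps_X)"
  have Q: "Q = 1 + fps_const (k * (1 + x)) * fps_X + fps_const (k * k * x) * fps_X * fps_X"
    by (simp add: Q_def algebra_simps fps_const_mult[symmetric] fps_const_add[symmetric]
        del: fps_const_mult fps_const_add)
  have dc: "fps_deriv c = fps_deriv g * f ^ j + g * (of_nat j * fps_deriv f * f ^ (j - 1))"
    by (simp add: c_def fps_deriv_power' algebra_simps)
  have "Q * fps_deriv c = (Q * fps_deriv g) * f ^ j + of_nat j * (g * f ^ (j - 1)) * (Q * fps_deriv f)"
    unfolding dc by (simp add: algebra_simps)
  also have "\<dots> = of_nat j * (g * f ^ (j - 1))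
      - (fps_const (k * x + 1) + fps_const (k * x * (k + 1)) * fps_X) * c"
    unfolding Q_def ode_g ode_f c_def 
    by (simp only: mult_1_right minus_mult_left[symmetric] mult.assoc uminus_add_conv_diff)
  finally have ode: "fps_deriv c + fps_const (k * (1 + x)) * (fps_X * fps_deriv c)
      + fps_const (k * k * x) * (fps_X * (fps_X * fps_deriv c))
      = fps_const (of_nat j) * (g * f ^ (j - 1)) - fps_const (k * x + 1) * c
        - fps_const (k * x * (k + 1)) * (fps_X * c)"
    unfolding Q by (simp add: algebra_simps fps_of_nat)
  have shift: "fps_nth (fps_X * fps_deriv c) m = of_nat m * fps_nth c m" for m
    by (simp add: fps_mult_fps_X_deriv_shift)
  have "of_nat (Suc n) * fps_nth c (Suc n) + k * (1 + x) * (of_nat n * fps_nth c n)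
      + k * k * x * (if n = 0 then 0 else of_nat (n - 1) * fps_nth c (n - 1))
      = of_nat j * fps_nth (g * f ^ (j - 1)) n - (k * x + 1) * fps_nth c n
        - k * x * (k + 1) * (if n = 0 then 0 else fps_nth c (n - 1))"
    using arg_cong[OF ode, of "\<lambda>h. fps_nth h n"]
    by (simp only: fps_add_nth fps_sub_nth fps_mult_left_const_nth shift fps_deriv_nth Suc_eq_plus1
        fps_X_mult_nth[where f = c] fps_X_mult_nth[where f = "fps_X * fps_deriv c"])
  \<comment> \<open>The terms in c_(n-1) combine by k^2 x (n-1) + kx(k+1) = kx(kn+1).\<close>
  then show ?thesis by (cases n) (simp_all add: algebra_simps)
qed

text \<open>Rescaling by n!/j! turns the factor j into a shift of the column, and n! = n (n-1)!
  produces the extra factor n, which also covers \<open>n = 0\<close>.\<close>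

lemma exp_riordan_recurrence:
  "exp_riordan g f (Suc n) j
    = (if j = 0 then 0 else exp_riordan g f n (j - 1))
      - (k * x + 1 + k * (1 + x) * of_nat n) * exp_riordan g f n j
      - k * x * of_nat n * (k * of_nat n + 1) * exp_riordan g f (n - 1) j"
proof -
  have "exp_riordan g f (Suc n) j
      = fact n / fact j * (of_nat (Suc n) * fps_nth (g * f ^ j) (Suc n))"
    by (simp add: exp_riordan_def algebra_simps del: of_nat_Suc)
  also have "\<dots> = fact n / fact j * (of_nat j * fps_nth (g * f ^ (j - 1)) n)
      - (k * x + 1 + k * (1 + x) * of_nat n) * exp_riordan g f n j
      - fact n / fact j * (if n = 0 then 0 else k * x * (k * of_nat n + 1) * fps_nth (g * f ^ j) (n - 1))"
    unfolding column_recurrence exp_riordan_def right_diff_distrib by (simp add: mult_ac)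
  also have "fact n / fact j * (of_nat j * fps_nth (g * f ^ (j - 1)) n)
      = (if j = 0 then 0 else exp_riordan g f n (j - 1))"
    by (cases j) (simp_all add: exp_riordan_def field_simps del: of_nat_Suc)
  also have "fact n / fact j * (if n = 0 then 0 else k * x * (k * of_nat n + 1) * fps_nth (g * f ^ j) (n - 1))
      = k * x * of_nat n * (k * of_nat n + 1) * exp_riordan g f (n - 1) j"
    by (cases n) (simp_all add: exp_riordan_def mult_ac del: of_nat_Suc)
  finally show ?thesis .
qed

section \<open>Inverse array, moments and orthogonality\<close>

lemma lt_inverse_riordan: "lt_inverse (exp_riordan g f) (exp_riordan g' f')"
  by (rule lt_inverse_exp_riordan) (simp_all add: f_nth_1[simplified] f_compose_f' g'_mult_g_compose_f')

text \<open>Substituting kz for z multiplies the n-th coefficient by k^n and turns e^(z(x-1)) into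
  \<open>E\<close>.\<close>

lemma k_eulerian_eq: "k_eulerian k n x = fact n * fps_nth (fps_pow1 B (1 / k)) n"
proof -
  have exp: "fps_exp (x - 1) oo (fps_const k * fps_X) = E"
    unfolding fps_exp_compose_linear E_def by (simp only: mult.commute)
  have "(fps_const (1 - x) / (fps_exp (x - 1) - fps_const x)) oo (fps_const k * fps_X) = B"
    using x_neq_1 exp
    by (subst fps_divide_compose) (simp_all add: fps_compose_sub_distrib B_def)
  then have "fps_pow1 B (1 / k)
      = fps_pow1 (fps_const (1 - x) / (fps_exp (x - 1) - fps_const x)) (1 / k) oo (fps_const k * fps_X)"
    using x_neq_1 by (subst fps_pow1_compose) simp_all
  then show ?thesis by (simp add: k_eulerian_def savage_viswanathan_def)
qed

lemma initial_column: "exp_riordan g' f' n 0 = k_eulerian k (n + 1) x"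
  by (simp add: exp_riordan_def g'_eq_deriv k_eulerian_eq algebra_simps)

text \<open>Together with \<open>k_nonzero\<close>, the assumptions keep the recurrence coefficient
  kxn(kn+1) nonzero for n > 0.\<close>

lemma orthogonal:
  assumes x: "x \<noteq> 0" and k: "\<And>n. k * of_nat n + 1 \<noteq> 0"
  shows "\<exists>p. coefficient_array (exp_riordan g f) p \<and>
    orthogonal_with_moments p (\<lambda>n. k_eulerian k (n + 1) x)"
proof -
  define p where "p n = (\<Sum>j\<le>n. monom (exp_riordan g f n j) j)" for n
  have lower: "lower_triangular (exp_riordan g f)" by (simp add: lower_triangular_exp_riordan)
  have coeff_p: "coeff (p n) j = exp_riordan g f n j" for n j
    using lower by (auto simp: p_def coeff_sum lower_triangular_def)
  have "orthogonal_with_moments p (\<lambda>n. k_eulerian k (n + 1) x)"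
  proof (rule orthogonal_of_three_term_recurrence)
    show "p 0 = 1" by (simp add: p_def exp_riordan_def)
    show "p (Suc n) = pCons 0 (p n) - smult (k * x + 1 + k * (1 + x) * of_nat n) (p n)
        - smult (k * x * of_nat n * (k * of_nat n + 1)) (p (n - 1))" for n
      by (rule poly_eqI) (simp add: coeff_p coeff_pCons exp_riordan_recurrence[of n] split: nat.split)
    show "k * x * of_nat n * (k * of_nat n + 1) \<noteq> 0" if "n > 0" for n
      using that x k k_nonzero by simp
    show "moment_functional (\<lambda>n. k_eulerian k (n + 1) x) (p n) = (if n = 0 then 1 else 0)" for n
    proof -
      have "degree (p n) \<le> n"
        using lower by (intro degree_le) (simp add: coeff_p lower_triangular_def)
      then have "moment_functional (\<lambda>n. k_eulerian k (n + 1) x) (p n)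
          = lt_mult (exp_riordan g f) (exp_riordan g' f') n 0"
        by (simp add: moment_functional_altdef coeff_p lt_mult_def initial_column)
      then show ?thesis using lt_inverse_riordan by (simp add: lt_inverse_def lt_one_def)
    qed
  qed simp
  moreover have "coefficient_array (exp_riordan g f) p"
    using lower by (simp add: coefficient_array_def p_def)
  ultimately show ?thesis by blast
qed

end

section \<open>Specialization to the rational function field\<close>

lemma indet_k_nonzero: "indet_k \<noteq> 0" and indet_x_nonzero: "indet_x \<noteq> 0"
  by (simp_all add: indet_k_def indet_x_def)

lemma indet_x_neq_1: "indet_x \<noteq> 1"
proof -
  have "[:0, 1:] \<noteq> (1 :: rat poly poly)" by (simp add: one_pCons)
  then show ?thesis unfolding indet_x_def by (metis to_fract_1 to_fract_eq_iff)
qed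

text \<open>The element comes from a polynomial in k with constant coefficient 1, which is not
  zero.\<close>

lemma indet_k_mult_nat: "indet_k * of_nat n + 1 \<noteq> 0"
proof -
  have "(of_nat n :: ratfun) = to_fract (of_nat n)"
    by (simp add: to_fract_def of_nat_fract)
  then have "indet_k * of_nat n + 1 = to_fract ([:[:0, 1:]:] * of_nat n + 1)"
    by (simp only: indet_k_def to_fract_mult to_fract_add to_fract_1)
  also have "[:[:0, 1:]:] * of_nat n + 1 = [:[:1, of_nat n:] :: rat poly:]"
    by (simp add: of_nat_poly one_pCons)
  finally show ?thesis by simp
qed

theorem proposition11:
  fixes x k :: ratfun and g f g' f' :: "ratfun fps" and M N :: "nat \<Rightarrow> nat \<Rightarrow> ratfun"
  defines "x \<equiv> indet_x" and "k \<equiv> indet_k"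
  defines "g \<equiv> 1 / ((1 + fps_const (k * x) * fps_X) * fps_pow1 (1 + fps_const k * fps_X) (1 / k))"
  defines "f \<equiv> fps_const (1 / (k * (1 - x))) *
      fps_log1 ((1 + fps_const k * fps_X) / (1 + fps_const (k * x) * fps_X))"
  defines "g' \<equiv> fps_exp (k * (x - 1)) *
      fps_pow1 (fps_const (1 - x) / (fps_exp (k * (x - 1)) - fps_const x)) (1 / k + 1)"
  defines "f' \<equiv> (fps_exp k - fps_exp (k * x)) /
      (fps_const k * (fps_exp (k * x) - fps_const x * fps_exp k))"
  defines "M \<equiv> exp_riordan g f" and "N \<equiv> exp_riordan g' f'"
  shows "exp_riordan_admissible g f \<and>
    (\<exists>p. coefficient_array M p \<and> orthogonal_with_moments p (\<lambda>n. k_eulerian k (n + 1) x)) \<and>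
    exp_riordan_admissible g' f' \<and>
    lt_inverse M N \<and>
    (\<forall>n. N n 0 = k_eulerian k (n + 1) x)"
proof -
  interpret R: eulerian_riordan k x
    by standard (simp_all add: k_def x_def indet_k_nonzero indet_x_neq_1)
  have defs: "g = R.g" "f = R.f" "g' = R.g'" "f' = R.f'"
    by (simp_all only: g_def f_def g'_def f'_def R.g_def R.f_def R.g'_def R.f'_def R.E_def R.B_def)
  have "x \<noteq> 0" "\<And>n. k * of_nat n + 1 \<noteq> 0"
    by (simp_all only: k_def x_def indet_x_nonzero indet_k_mult_nat not_False_eq_True)
  moreover have "fps_nth R.g' 0 = 1" by (simp add: R.g'_eq)
  ultimately show ?thesis
    unfolding M_def N_def defs exp_riordan_admissible_def R.f_nth_1 R.f'_nth_1
    using R.orthogonal R.lt_inverse_riordan R.initial_column R.g_nth_0 R.f_nth_0 R.f'_nth_0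
    by (metis one_neq_zero)
qed

end
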